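(* Let $l,k,s$ be positive integers with $2\le l\le 2s$, let $m\in\mathbb{R}$, and consider the planar polynomial system $$\dot x = y^{2l-1}-x^{2k+1},\qquad \dot y=-x+m\,y^{2s+1}.$$ Let $m^*=\dfrac{(2k+1)!!}{(2kl+1)!_{(2l)}}$. Then: (i) When $s<kl$, the origin is an attractor for $m\le 0$ and a repeller for $m>0$. (ii) When $s>kl$, the origin is always (i.e. for every $m\in\mathbb{R}$) an attractor. (iii) When $s=kl$, the origin is an attractor for $m<m^*$ and a repeller for $m>m^*$.
   Context: For a non-negative real number $a$ and a positive integer $n$, $a!_{(n)}$ is defined recursively by $a!_{(n)}=a\cdot (a-n)!_{(n)}$ if $a>0$ and $a!_{(n)}=1$ if $a\le 0$; $a!!$ abbreviates $a!_{(2)}$. Thus $(2k+1)!!=\prod_{j=0}^{k}(2j+1)$ and $(2kl+1)!_{(2l)}=\prod_{j=0}^{k}(2jl+1)$. The origin is called an attractor if it is a (locally) asymptotically stable equilibrium of the system, and a repeller if it is (locally) asymptotically stable for the system with time reversed. (Under the condition $2\le l\le 2s$ the origin is a monodromic nilpotent critical point.) *)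

theory Defs
  imports "HOL-Analysis.Analysis"
begin

text \<open>
  The generalised factorial of step \<open>n\<close>. Only \<open>n > 0\<close> is meaningful; the value 1 for
  \<open>n = 0\<close> is a dummy that makes the recursion terminate.
\<close>
function multifactorial :: "real \<Rightarrow> nat \<Rightarrow> real" where
  "multifactorial a n = (if a \<le> 0 \<or> n = 0 then 1 else a * multifactorial (a - real n) n)"
  by pat_completeness auto
termination
proof (relation "Wellfounded.measure (\<lambda>(a, n). nat \<lceil>a\<rceil>)")
  fix a :: real and n :: nat
  assume "\<not> (a \<le> 0 \<or> n = 0)"
  then have "0 < \<lceil>a\<rceil>" and "\<lceil>a - real n\<rceil> < \<lceil>a\<rceil>"
    by linarith+
  then show "((a - real n, n), (a, n)) \<in> Wellfounded.measure (\<lambda>(a, n). nat \<lceil>a\<rceil>)"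
    by simp
qed simp

declare multifactorial.simps [simp del]

abbreviation double_factorial :: "real \<Rightarrow> real" where
  "double_factorial a \<equiv> multifactorial a 2"

lemma multifactorial_eq_prod:
  assumes "n \<ge> 1"
  shows "multifactorial (real (k * n + 1)) n = (\<Prod>j=0..k. real (j * n + 1))"
proof (induction k)
  case 0
  then show ?case
    using assms
    by (simp add: multifactorial.simps[of 1] multifactorial.simps[of "1 - real n"])
next
  case (Suc k)
  have "multifactorial (real (Suc k * n + 1)) n
        = real (Suc k * n + 1) * multifactorial (real (Suc k * n + 1) - real n) n"
  proof -
    have "\<not> (real (Suc k * n + 1) \<le> 0 \<or> n = 0)"
      using assms by (simp only: of_nat_le_0_iff) simp
    then show ?thesis
      by (subst multifactorial.simps) (simp only: if_False)
  qed
  also have "real (Suc k * n + 1) - real n = real (k * n + 1)"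
    by simp
  finally show ?case
    using Suc by (simp add: algebra_simps)
qed

definition solution_on :: "('a::real_normed_vector \<Rightarrow> 'a) \<Rightarrow> (real \<Rightarrow> 'a) \<Rightarrow> real set \<Rightarrow> bool" where
  "solution_on f u J \<longleftrightarrow> (\<forall>t\<in>J. (u has_vector_derivative f (u t)) (at t within J))"

text \<open>
  Global forward existence near the equilibrium is part of the notion of stability, so that it
  cannot hold vacuously. The \<open>\<epsilon>\<close>-bound is imposed on every solution on every interval
  \<open>[0, T)\<close>, hence also on solutions on \<open>[0, \<infinity>)\<close>.
\<close>
definition lyapunov_stable :: "('a::real_normed_vector \<Rightarrow> 'a) \<Rightarrow> 'a \<Rightarrow> bool" where
  "lyapunov_stable f p \<longleftrightarrow>
     (\<forall>\<epsilon>>0. \<exists>\<delta>>0. \<forall>a. dist a p < \<delta> \<longrightarrow>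
        (\<exists>u. solution_on f u {0..} \<and> u 0 = a) \<and>
        (\<forall>u T. solution_on f u {0..<T} \<and> u 0 = a \<longrightarrow> (\<forall>t\<in>{0..<T}. dist (u t) p < \<epsilon>)))"

definition locally_attractive :: "('a::real_normed_vector \<Rightarrow> 'a) \<Rightarrow> 'a \<Rightarrow> bool" where
  "locally_attractive f p \<longleftrightarrow>
     (\<exists>\<delta>>0. \<forall>a. dist a p < \<delta> \<longrightarrow>
        (\<exists>u. solution_on f u {0..} \<and> u 0 = a) \<and>
        (\<forall>u. solution_on f u {0..} \<and> u 0 = a \<longrightarrow> (u \<longlongrightarrow> p) at_top))"

definition asymptotically_stable_equilibrium :: "('a::real_normed_vector \<Rightarrow> 'a) \<Rightarrow> 'a \<Rightarrow> bool" where
  "asymptotically_stable_equilibrium f p \<longleftrightarrow>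
     f p = 0 \<and> lyapunov_stable f p \<and> locally_attractive f p"

definition attractor :: "('a::real_normed_vector \<Rightarrow> 'a) \<Rightarrow> 'a \<Rightarrow> bool" where
  "attractor f p \<longleftrightarrow> asymptotically_stable_equilibrium f p"

text \<open>Reversing time in \<open>z' = f z\<close> gives \<open>z' = - f z\<close>.\<close>
definition repeller :: "('a::real_normed_vector \<Rightarrow> 'a) \<Rightarrow> 'a \<Rightarrow> bool" where
  "repeller f p \<longleftrightarrow> asymptotically_stable_equilibrium (\<lambda>z. - f z) p"

definition planar_system :: "nat \<Rightarrow> nat \<Rightarrow> nat \<Rightarrow> real \<Rightarrow> real \<times> real \<Rightarrow> real \<times> real" where
  "planar_system k l s m = (\<lambda>(x, y). (y ^ (2 * l - 1) - x ^ (2 * k + 1), - x + m * y ^ (2 * s + 1)))"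

definition m_star :: "nat \<Rightarrow> nat \<Rightarrow> real" where
  "m_star k l = double_factorial (real (2 * k + 1)) / multifactorial (real (2 * k * l + 1)) (2 * l)"

end

theory Submission imports Defs begin

text \<open>
  Take the Hamiltonian \<open>H = x\<^sup>2 / 2 + y ^ (2 * l) / (2 * l)\<close> of the principal part
  \<open>(y ^ (2 * l - 1), - x)\<close>; its derivative along the system is
  \<open>- x ^ (2 * k + 2) + m * y ^ (2 * l + 2 * s)\<close>, which is
  not definite in general. There is a polynomial \<open>W\<close>
  whose derivative along the principal part is \<open>m* y ^ (2 * l * (k + 1)) - x ^ (2 * k + 2)\<close>,
  so that passing from \<open>H\<close> to \<open>H - \<theta> W\<close> trades the fraction \<open>\<theta>\<close> of the term in \<open>x\<close> for
  \<open>\<theta> m*\<close> times a term in \<open>y\<close>. For a suitable real \<open>\<theta>\<close> the leading part becomes definite,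
  and \<open>l \<le> 2 * s\<close> makes the derivative of \<open>W\<close> along the remaining terms of higher order. Lyapunov's
  direct method then applies; global forward solutions come from Picard iteration for the field
  cut off by the projection onto a ball.
\<close>

section \<open>Lyapunov's direct method\<close>

lemma integral_has_vector_derivative_half_line:
  fixes h :: "real \<Rightarrow> 'a::banach"
  assumes "continuous_on {0..} h" "0 \<le> t"
  shows "((\<lambda>t. integral {0..t} h) has_vector_derivative h t) (at t within {0..})"
proof -
  \<comment> \<open>With right end \<open>t+1\<close> the interval agrees with the half-line near
    \<open>t\<close>, so the filter \<open>at t within\<close> is the same for both.\<close>
  have "((\<lambda>t. integral {0..t} h) has_vector_derivative h t) (at t within {0..t+1})"
    using assms by (intro integral_has_vector_derivative continuous_on_subset[OF assms(1)]) auto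
  moreover have "at t within {0..t+1} = at t within {0..}"
    by (rule at_within_nhd[where S = "{..<t+1}"]) auto
  ultimately show ?thesis by simp
qed

text \<open>Banach's fixed point theorem in Bielecki's weighted norm: the unknown is
  \<open>exp (- K * t) *\<^sub>R u t\<close>, and for \<open>K > L\<close> the Picard operator
  contracts by \<open>L / K\<close> on the whole half-line at once, so no local solutions have to be
  glued.\<close>

lemma lipschitz_bounded_global_solution:
  fixes g :: "'a::banach \<Rightarrow> 'a"
  assumes lip: "L-lipschitz_on UNIV g" and bdd: "bounded (range g)"
  shows "\<exists>u. solution_on g u {0..} \<and> u 0 = a"
proof -
  \<comment> \<open>\<open>L < K\<close> gives the contraction; \<open>1 \<le> K\<close> gives
    \<open>t \<le> K * t \<le> exp (K * t)\<close>, which keeps the weighted integral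
    bounded.\<close>
  define K where "K = L + 1"
  have L0: "0 \<le> L" using lip lipschitz_on_nonneg by blast
  have K: "1 \<le> K" "L < K" using L0 by (auto simp: K_def)
  obtain B where B: "\<And>x. norm (g x) \<le> B" using bdd by (auto simp: bounded_iff)
  have B0: "0 \<le> B" using B[of 0] norm_ge_zero order_trans by blast
  have contg: "continuous_on UNIV g" using lip by (rule lipschitz_on_continuous_on)
  \<comment> \<open>The factor \<open>exp (K * s)\<close> removes the weight from \<open>v\<close>,
    so \<open>h v\<close> is the field along the candidate solution.\<close>
  define h where "h v s = g (exp (K * s) *\<^sub>R apply_bcontfun v s)"
    for v :: "real \<Rightarrow>\<^sub>C 'a" and s
  have conth: "continuous_on S (h v)" for S v
    unfolding h_def
    by (rule continuous_on_compose2[OF contg]) (auto intro!: continuous_intros)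
  have inth: "h v integrable_on {0..t}" for v t
    by (rule integrable_continuous_real[OF conth])
  define P where "P v t = exp (- K * t) *\<^sub>R (a + integral {0..t} (h v))" for v t
  have contP: "continuous_on UNIV (\<lambda>t. P v (max 0 t))" for v
  proof -
    have "continuous_on {0..} (\<lambda>t. integral {0..t} (h v))"
      unfolding continuous_on_eq_continuous_within
      using has_vector_derivative_continuous[OF integral_has_vector_derivative_half_line[OF conth]]
      by auto
    then have "continuous_on {0..} (P v)"
      unfolding P_def by (intro continuous_intros)
    then show ?thesis
      by (rule continuous_on_compose2) (auto intro!: continuous_intros)
  qed
  have bdP: "norm (P v t) \<le> norm a + B" if "0 \<le> t" for v t
  proof -
    have "norm (integral {0..t} (h v)) \<le> B * (t - 0)"
      by (rule integral_bound[OF that conth]) (simp add: h_def B)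
    also have "\<dots> \<le> B * exp (K * t)"
    proof -
      have "t \<le> K * t" using K that by (simp add: mult_le_cancel_right1)
      also have "\<dots> \<le> exp (K * t)" using exp_ge_add_one_self[of "K * t"] by linarith
      finally show ?thesis using B0 by (simp add: mult_left_mono)
    qed
    finally have i: "norm (integral {0..t} (h v)) \<le> B * exp (K * t)" .
    have e: "1 \<le> exp (K * t)" using K that by simp
    have "norm (a + integral {0..t} (h v)) \<le> norm a * exp (K * t) + B * exp (K * t)"
      using norm_triangle_ineq[of a "integral {0..t} (h v)"] i
        mult_left_mono[OF e norm_ge_zero[of a]] by simp
    then have "norm (P v t) \<le> exp (- K * t) * ((norm a + B) * exp (K * t))"
      unfolding P_def norm_scaleR distrib_right[symmetric] by simp
    also have "\<dots> = norm a + B" by (simp add: exp_minus)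
    finally show ?thesis .
  qed
  \<comment> \<open>Bounded continuous functions live on the whole real line here;
    \<open>max 0 t\<close> extends the operator to negative times by its value at 0.\<close>
  define F where "F v = Bcontfun (\<lambda>t. P v (max 0 t))" for v
  have F: "apply_bcontfun (F v) t = P v (max 0 t)" for v t
    unfolding F_def
    by (subst Bcontfun_inverse) (auto intro!: bcontfun_normI contP bdP)
  have contr: "dist (F v) (F w) \<le> L / K * dist v w" for v w
  proof (rule dist_bound)
    fix t :: real
    define \<tau> where "\<tau> = max 0 t"
    have t0: "0 \<le> \<tau>" by (simp add: \<tau>_def)
    define d where "d = dist v w"
    have ex: "((\<lambda>s. L * d * exp (K * s)) has_integral
                (L * d / K * exp (K * \<tau>) - L * d / K * exp (K * 0))) {0..\<tau>}"
      using t0 K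
      by (intro fundamental_theorem_of_calculus)
         (auto intro!: derivative_eq_intros simp: has_real_derivative_iff_has_vector_derivative[symmetric])
    \<comment> \<open>Integrating the weight gains the factor \<open>1 / K\<close>: the right-hand
      integral is at most \<open>L * d / K * exp (K * \<tau>)\<close>, and the outer weight then
      cancels the exponential.\<close>
    have "norm (integral {0..\<tau>} (\<lambda>s. h v s - h w s)) \<le> integral {0..\<tau>} (\<lambda>s. L * d * exp (K * s))"
    proof (rule Henstock_Kurzweil_Integration.integral_norm_bound_integral)
      show "(\<lambda>s. h v s - h w s) integrable_on {0..\<tau>}" by (intro integrable_diff inth)
      show "(\<lambda>s. L * d * exp (K * s)) integrable_on {0..\<tau>}" using ex by blast
      fix s
      have "norm (h v s - h w s)
          \<le> L * dist (exp (K * s) *\<^sub>R apply_bcontfun v s) (exp (K * s) *\<^sub>R apply_bcontfun w s)"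
        unfolding h_def dist_norm[symmetric] by (rule lipschitz_onD[OF lip]) auto
      also have "\<dots> = L * (exp (K * s) * dist (apply_bcontfun v s) (apply_bcontfun w s))"
        by (simp add: dist_norm scaleR_diff_right[symmetric])
      also have "\<dots> \<le> L * (exp (K * s) * d)"
        unfolding d_def using L0 by (intro mult_left_mono dist_bounded) auto
      finally show "norm (h v s - h w s) \<le> L * d * exp (K * s)" by (simp add: ac_simps)
    qed
    also have "\<dots> = L * d / K * exp (K * \<tau>) - L * d / K" using integral_unique[OF ex] by simp
    also have "\<dots> \<le> L * d / K * exp (K * \<tau>)" using L0 K by (simp add: d_def)
    finally have i: "norm (integral {0..\<tau>} (\<lambda>s. h v s - h w s)) \<le> L * d / K * exp (K * \<tau>)" .
    have "P v \<tau> - P w \<tau> = exp (- K * \<tau>) *\<^sub>R integral {0..\<tau>} (\<lambda>s. h v s - h w s)"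
      unfolding P_def integral_diff[OF inth inth] by (simp add: algebra_simps)
    then have "dist (P v \<tau>) (P w \<tau>) \<le> exp (- K * \<tau>) * (L * d / K * exp (K * \<tau>))"
      unfolding dist_norm using mult_left_mono[OF i, of "exp (- K * \<tau>)"] by simp
    also have "\<dots> = L / K * d" by (simp add: exp_minus)
    finally show "dist (apply_bcontfun (F v) t) (apply_bcontfun (F w) t) \<le> L / K * dist v w"
      by (simp add: F \<tau>_def d_def)
  qed
  have "\<exists>!v. F v = v"
    using contr L0 K by (intro banach_fix_type[where c = "L / K"]) auto
  then obtain v where v: "F v = v" by blast
  define u where "u t = a + integral {0..t} (h v)" for t
  have h_u: "h v t = g (u t)" if "0 \<le> t" for t
  proof -
    have "apply_bcontfun v t = exp (- K * t) *\<^sub>R u t"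
      using F[of v t] that unfolding v P_def u_def by simp
    then show ?thesis by (simp add: h_def exp_minus)
  qed
  have "solution_on g u {0..}"
    unfolding solution_on_def
  proof
    fix t :: real assume "t \<in> {0..}"
    then have t: "0 \<le> t" by simp
    have "(u has_vector_derivative h v t) (at t within {0..})"
      unfolding u_def
      by (rule derivative_eq_intros integral_has_vector_derivative_half_line conth t refl | simp)+
    then show "(u has_vector_derivative g (u t)) (at t within {0..})" using h_u t by simp
  qed
  moreover have "u 0 = a" by (simp add: u_def)
  ultimately show ?thesis by blast
qed

section \<open>Lyapunov functions along solutions\<close>

lemma solution_on_subset:
  assumes "solution_on f u J" "I \<subseteq> J"
  shows "solution_on f u I"
  using assms unfolding solution_on_def
  by (meson has_vector_derivative_within_subset subset_iff)

lemma solution_on_continuous_on: "solution_on f u J \<Longrightarrow> continuous_on J u"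
  unfolding solution_on_def continuous_on_eq_continuous_within
  using has_vector_derivative_continuous by fast

lemma solution_on_cong:
  assumes "\<And>t. t \<in> J \<Longrightarrow> f (u t) = g (u t)"
  shows "solution_on f u J \<longleftrightarrow> solution_on g u J"
  using assms by (simp add: solution_on_def)

text \<open>The mean value theorem for \<open>V\<close> composed with \<open>u\<close>. Taking
  \<open>c = 0\<close> gives monotonicity, a negative \<open>c\<close> gives linear decay.\<close>

lemma solution_on_increment_le:
  fixes V :: "'a::real_normed_vector \<Rightarrow> real"
  assumes sol: "solution_on f u {a..b}" and "a \<le> b"
    and der: "\<And>t. t \<in> {a..b} \<Longrightarrow> (V has_derivative V' (u t)) (at (u t))"
    and le: "\<And>t. t \<in> {a..b} \<Longrightarrow> V' (u t) (f (u t)) \<le> c"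
  shows "V (u b) - V (u a) \<le> c * (b - a)"
proof -
  have "\<exists>t\<in>{a..b}. V (u b) - V (u a) = V' (u t) ((b - a) *\<^sub>R f (u t))"
  proof (rule mvt_very_simple[OF \<open>a \<le> b\<close>])
    fix t assume "a \<le> t" "t \<le> b"
    then have t: "t \<in> {a..b}" by simp
    show "((\<lambda>t. V (u t)) has_derivative (\<lambda>x. V' (u t) (x *\<^sub>R f (u t)))) (at t within {a..b})"
      using sol t
      by (intro has_derivative_compose[where g = V and f = u, OF _ der[OF t]])
         (simp add: solution_on_def has_vector_derivative_def)
  qed
  then obtain t where t: "t \<in> {a..b}" and eq: "V (u b) - V (u a) = V' (u t) ((b - a) *\<^sub>R f (u t))"
    by blast
  have "V' (u t) ((b - a) *\<^sub>R f (u t)) = (b - a) *\<^sub>R V' (u t) (f (u t))"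
    using der[OF t] by (simp add: has_derivative_bounded_linear linear_simps)
  then show ?thesis using mult_left_mono[OF le[OF t], of "b - a"] eq \<open>a \<le> b\<close>
    by (simp add: mult.commute)
qed

text \<open>A first-exit argument: to leave the ball the solution must meet the sphere, where
  \<open>V\<close> is at least \<open>\<mu>\<close>, but \<open>V\<close> starts below
  \<open>\<mu>\<close> and cannot grow inside the ball.\<close>

lemma solution_on_trapped_in_ball:
  fixes u :: "real \<Rightarrow> 'a::real_normed_vector" and V :: "'a \<Rightarrow> real"
  assumes sol: "solution_on g u {0..T}" and T: "0 \<le> T"
    and der: "\<And>z. z \<in> cball 0 \<rho> \<Longrightarrow> (V has_derivative V' z) (at z)"
    and dec: "\<And>z. z \<in> cball 0 \<rho> \<Longrightarrow> V' z (g z) \<le> 0"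
    and sph: "\<And>z. norm z = \<rho> \<Longrightarrow> \<mu> \<le> V z"
    and u0: "norm (u 0) < \<rho>" "V (u 0) < \<mu>"
  shows "norm (u T) < \<rho>"
proof (rule ccontr)
  assume neg: "\<not> norm (u T) < \<rho>"
  have cont: "continuous_on {0..T} (\<lambda>t. norm (u t))"
    by (rule continuous_on_norm[OF solution_on_continuous_on[OF sol]])
  \<comment> \<open>The minimum \<open>t1\<close> of \<open>S\<close> is the first exit time. By the
    intermediate value theorem the norm equals \<open>\<rho>\<close> there, and up to then the
    solution is in the closed ball, where \<open>V\<close> does not increase.\<close>
  define S where "S = {0..T} \<inter> (\<lambda>t. norm (u t)) -` {\<rho>..}"
  have "closed S" unfolding S_def
    by (rule continuous_closed_preimage[OF cont]) auto
  moreover have "S = {0..T} \<inter> S" by (auto simp: S_def)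
  ultimately have "compact S" using compact_Int_closed[OF compact_Icc, of S] by metis
  moreover have "S \<noteq> {}" using neg T by (auto simp: S_def)
  ultimately have "\<exists>s\<in>S. \<forall>t\<in>S. s \<le> t" by (rule compact_attains_inf)
  then obtain t1 where t1: "t1 \<in> S" "\<And>t. t \<in> S \<Longrightarrow> t1 \<le> t" by blast
  have r: "0 \<le> t1" "t1 \<le> T" "\<rho> \<le> norm (u t1)" using t1 by (auto simp: S_def)
  have "\<exists>t\<ge>0. t \<le> t1 \<and> norm (u t) = \<rho>"
    using r u0 by (intro IVT'[where f = "\<lambda>t. norm (u t)"] continuous_on_subset[OF cont]) auto
  then have eq: "norm (u t1) = \<rho>"
  proof (elim exE conjE)
    fix t assume "0 \<le> t" "t \<le> t1" "norm (u t) = \<rho>"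
    then show ?thesis using t1(2)[of t] r by (simp add: S_def)
  qed
  have in_ball: "u t \<in> cball 0 \<rho>" if "t \<in> {0..t1}" for t
    using that t1(2)[of t] r eq by (cases "\<rho> \<le> norm (u t)") (auto simp: S_def)
  have "V (u t1) - V (u 0) \<le> 0 * (t1 - 0)"
  proof (rule solution_on_increment_le[where V = V and V' = V' and u = u and f = g])
    show "solution_on g u {0..t1}" using r by (intro solution_on_subset[OF sol]) auto
  qed (use r in_ball der dec in blast)+
  then show False using sph[OF eq] u0 by simp
qed

text \<open>Positive minima of \<open>V\<close> on small spheres trap solutions and give stability;
  strict decrease on compact sets away from 0 drives \<open>V\<close> to 0 along trapped solutions
  and gives attraction. The Lipschitz condition serves global existence.\<close>

theorem lyapunov_asymptotically_stable:
  fixes f :: "'a::euclidean_space \<Rightarrow> 'a" and V :: "'a \<Rightarrow> real"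
  assumes r: "0 < r" and lip: "L-lipschitz_on (cball 0 r) f" and f0: "f 0 = 0"
    and der: "\<And>z. z \<in> cball 0 r \<Longrightarrow> (V has_derivative V' z) (at z)"
    and V0: "V 0 = 0"
    and pos: "\<And>z. z \<in> cball 0 r \<Longrightarrow> z \<noteq> 0 \<Longrightarrow> 0 < V z"
    and contD: "continuous_on (cball 0 r) (\<lambda>z. V' z (f z))"
    and neg: "\<And>z. z \<in> cball 0 r \<Longrightarrow> z \<noteq> 0 \<Longrightarrow> V' z (f z) < 0"
  shows "asymptotically_stable_equilibrium f 0"
proof -
  have contV: "continuous_on (cball 0 r) V"
    by (intro continuous_at_imp_continuous_on ballI has_derivative_continuous[OF der])
  have V'0: "V' 0 (f 0) = 0"
    using der[of 0] r f0 by (simp add: has_derivative_bounded_linear linear_simps)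
  have le0: "V' z (f z) \<le> 0" if "z \<in> cball 0 r" for z
    using neg[OF that] V'0 by (cases "z = 0") auto
  \<comment> \<open>Leaving \<open>g\<close> free, as long as it agrees with \<open>f\<close> on the
    ball, lets one \<open>\<delta>\<close> serve both the cut-off field, whose solutions are known
    to exist, and \<open>f\<close> itself.\<close>
  have trap: "\<exists>\<delta>>0. \<forall>a g u T. norm a < \<delta> \<longrightarrow> (\<forall>z\<in>cball 0 \<rho>. g z = f z) \<longrightarrow> 0 \<le> T \<longrightarrow>
      solution_on g u {0..T} \<longrightarrow> u 0 = a \<longrightarrow> norm (u T) < \<rho>"
    if \<rho>: "0 < \<rho>" "\<rho> \<le> r" for \<rho>
  proof -
    have "\<exists>z\<in>sphere (0::'a) \<rho>. \<forall>w\<in>sphere 0 \<rho>. V z \<le> V w"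
      using \<rho> by (intro continuous_attains_inf continuous_on_subset[OF contV]) auto
    then obtain z0 where z0: "norm z0 = \<rho>" "\<And>w. norm w = \<rho> \<Longrightarrow> V z0 \<le> V w" by auto
    have "0 < V z0" using z0 \<rho> by (intro pos) auto
    moreover have "isCont V 0" using der[of 0] r by (intro has_derivative_continuous) auto
    ultimately obtain d where d: "0 < d" "\<And>z. norm z < d \<Longrightarrow> \<bar>V z\<bar> < V z0"
      unfolding continuous_at_eps_delta using V0 by (auto simp: dist_norm)
    then have d': "V z < V z0" if "norm z < d" for z using that abs_less_iff by blast
    show ?thesis
    proof (intro exI[of _ "min d \<rho>"] conjI allI impI)
      fix a u T and g :: "'a \<Rightarrow> 'a"
      assume *: "norm a < min d \<rho>" "\<forall>z\<in>cball 0 \<rho>. g z = f z" "0 \<le> T"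
        "solution_on g u {0..T}" "u 0 = a"
      show "norm (u T) < \<rho>"
        using * \<rho> d' z0
      proof (intro solution_on_trapped_in_ball[OF *(4,3), of \<rho> V V' "V z0"])
        fix z :: 'a assume "z \<in> cball 0 \<rho>"
        then show "(V has_derivative V' z) (at z)" "V' z (g z) \<le> 0"
          using \<rho> *(2) der[of z] le0[of z] by auto
      qed auto
    qed (use d \<rho> in auto)
  qed
  have stab: "\<exists>\<delta>>0. \<forall>a. norm a < \<delta> \<longrightarrow>
      (\<exists>u. solution_on f u {0..} \<and> u 0 = a) \<and>
      (\<forall>u t. solution_on f u {0..t} \<and> 0 \<le> t \<and> u 0 = a \<longrightarrow> norm (u t) < \<rho>)"
    if \<rho>: "0 < \<rho>" "\<rho> \<le> r" for \<rho>
  proof -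
    from trap[OF \<rho>] obtain \<delta> where "\<delta> > 0" and tr: "\<forall>a g u T. norm a < \<delta> \<longrightarrow>
        (\<forall>z\<in>cball 0 \<rho>. g z = f z) \<longrightarrow> 0 \<le> T \<longrightarrow> solution_on g u {0..T} \<longrightarrow> u 0 = a \<longrightarrow> norm (u T) < \<rho>"
      by (elim exE conjE)
    note \<delta> = \<open>\<delta> > 0\<close> tr[rule_format]
    have "\<exists>u. solution_on f u {0..} \<and> u 0 = a" if a: "norm a < \<delta>" for a
    proof -
      \<comment> \<open>Projection onto a closed ball is 1-Lipschitz, so \<open>f\<close> after
        \<open>p\<close> is globally Lipschitz and bounded. Its solution is trapped where
        \<open>p\<close> is the identity and therefore solves the original equation.\<close>
      define p where "p = closest_point (cball (0::'a) \<rho>)"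
      have p_in: "p z \<in> cball 0 \<rho>" for z
        unfolding p_def using \<rho> by (intro closest_point_in_set) auto
      have lip\<rho>: "L-lipschitz_on (cball 0 \<rho>) f"
        using \<rho> by (intro lipschitz_on_subset[OF lip] subset_cball)
      have "1-lipschitz_on UNIV p"
        unfolding p_def using \<rho> by (intro lipschitz_onI) (auto intro: closest_point_lipschitz)
      moreover have "L-lipschitz_on (range p) f"
        using p_in by (intro lipschitz_on_subset[OF lip\<rho>]) auto
      ultimately have lipfp: "L-lipschitz_on UNIV (\<lambda>z. f (p z))"
        using lipschitz_on_compose2[of 1 UNIV p L f] by simp
      have "compact (f ` cball 0 \<rho>)"
        by (intro compact_continuous_image lipschitz_on_continuous_on[OF lip\<rho>]) auto
      then have "bounded (range (\<lambda>z. f (p z)))"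
        by (rule bounded_subset[OF compact_imp_bounded]) (use p_in in auto)
      then obtain u where u: "solution_on (\<lambda>z. f (p z)) u {0..}" "u 0 = a"
        using lipschitz_bounded_global_solution[OF lipfp] by blast
      have p_eq: "p z = z" if "z \<in> cball 0 \<rho>" for z
        using that by (simp add: p_def closest_point_self)
      have "norm (u t) < \<rho>" if "0 \<le> t" for t
        using a p_eq that u by (intro \<delta>(2)[of a "\<lambda>z. f (p z)"] solution_on_subset[OF u(1)]) auto
      then have "solution_on f u {0..}"
        using u(1) p_eq by (subst (asm) solution_on_cong[where g = f]) (auto simp: less_imp_le)
      then show ?thesis using u(2) by blast
    qed
    moreover have "norm (u t) < \<rho>"
      if "norm a < \<delta>" "solution_on f u {0..t}" "0 \<le> t" "u 0 = a" for a u t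
      using that by (intro \<delta>(2)[of a f]) auto
    ultimately show ?thesis by (intro exI[of _ \<delta>] conjI allI impI \<delta>(1)) auto
  qed
  have "lyapunov_stable f 0"
    unfolding lyapunov_stable_def
  proof (intro allI impI)
    fix \<epsilon> :: real assume "\<epsilon> > 0"
    then obtain \<delta> where \<delta>: "\<delta> > 0" "\<And>a. norm a < \<delta> \<Longrightarrow> \<exists>u. solution_on f u {0..} \<and> u 0 = a"
      "\<And>a u t. norm a < \<delta> \<Longrightarrow> solution_on f u {0..t} \<Longrightarrow> 0 \<le> t \<Longrightarrow> u 0 = a \<Longrightarrow> norm (u t) < min \<epsilon> r"
      using stab[of "min \<epsilon> r"] r by auto
    have "norm (u t) < \<epsilon>" if "norm a < \<delta>" "solution_on f u {0..<T}" "u 0 = a" "t \<in> {0..<T}" for a u T t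
      using that \<delta>(3)[of a u t] solution_on_subset[OF that(2), of "{0..t}"]
      by (auto simp: subset_eq)
    then show "\<exists>\<delta>>0. \<forall>a. dist a 0 < \<delta> \<longrightarrow> (\<exists>u. solution_on f u {0..} \<and> u 0 = a) \<and>
        (\<forall>u T. solution_on f u {0..<T} \<and> u 0 = a \<longrightarrow> (\<forall>t\<in>{0..<T}. dist (u t) 0 < \<epsilon>))"
      using \<delta> by (intro exI[of _ \<delta>]) auto
  qed
  moreover have "locally_attractive f 0"
  proof -
    obtain \<delta> where \<delta>: "\<delta> > 0" "\<And>a. norm a < \<delta> \<Longrightarrow> \<exists>u. solution_on f u {0..} \<and> u 0 = a"
      "\<And>a u t. norm a < \<delta> \<Longrightarrow> solution_on f u {0..t} \<Longrightarrow> 0 \<le> t \<Longrightarrow> u 0 = a \<Longrightarrow> norm (u t) < r"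
      using stab[of r] r by auto
    have "(u \<longlongrightarrow> 0) at_top" if "norm a < \<delta>" and sol: "solution_on f u {0..}" "u 0 = a" for a u
    proof -
      have ub: "u t \<in> cball 0 r" if "0 \<le> t" for t
        using \<delta>(3)[OF \<open>norm a < \<delta>\<close> solution_on_subset[OF sol(1)] that sol(2)]
        by (simp add: less_imp_le)
      have incr: "V (u t) - V (u s) \<le> c * (t - s)"
        if "0 \<le> s" "s \<le> t" "\<And>\<tau>. \<tau> \<in> {s..t} \<Longrightarrow> V' (u \<tau>) (f (u \<tau>)) \<le> c" for s t c
      proof (rule solution_on_increment_le[where V = V and V' = V' and u = u and f = f])
        show "solution_on f u {s..t}" using that by (intro solution_on_subset[OF sol(1)]) auto
        show "(V has_derivative V' (u \<tau>)) (at (u \<tau>))" if "\<tau> \<in> {s..t}" for \<tau>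
          using that \<open>0 \<le> s\<close> by (intro der ub) auto
      qed (use that in blast)+
      have mono: "V (u t) \<le> V (u s)" if "0 \<le> s" "s \<le> t" for s t
        using incr[of s t 0] that ub le0 by auto
      \<comment> \<open>If \<open>V\<close> stayed at or above \<open>c\<close>, the solution would
        remain in the compact set \<open>S\<close>, which misses 0 because \<open>V 0 = 0\<close>.
        There the derivative is at most some \<open>- \<eta> < 0\<close>, so by time
        \<open>V (u 0) / \<eta>\<close> the value of \<open>V\<close> would have dropped to 0 or
        below.\<close>
      have small: "\<exists>t\<ge>0. V (u t) < c" if "0 < c" for c
      proof (rule ccontr)
        assume "\<not> ?thesis"
        then have ge: "c \<le> V (u t)" if "0 \<le> t" for t using that by force
        define S where "S = cball 0 r \<inter> V -` {c..}"
        have "closed S" unfolding S_def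
          by (rule continuous_closed_preimage[OF contV]) auto
        moreover have "S = cball 0 r \<inter> S" by (auto simp: S_def)
        ultimately have S: "compact S" using compact_Int_closed[OF compact_cball, of S] by metis
        have "u 0 \<in> S" using ub ge by (auto simp: S_def)
        then have "\<exists>z\<in>S. \<forall>w\<in>S. V' w (f w) \<le> V' z (f z)"
          using S by (intro continuous_attains_sup continuous_on_subset[OF contD]) (auto simp: S_def)
        then obtain z where z: "z \<in> S" "\<And>w. w \<in> S \<Longrightarrow> V' w (f w) \<le> V' z (f z)" by blast
        define \<eta> where "\<eta> = - V' z (f z)"
        have "\<eta> > 0" using z(1) neg[of z] \<open>0 < c\<close> V0 by (cases "z = 0") (auto simp: S_def \<eta>_def)
        have lin: "V (u t) - V (u 0) \<le> - \<eta> * (t - 0)" if "0 \<le> t" for t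
          using that ub ge z(2) by (intro incr) (auto simp: S_def \<eta>_def)
        have "0 \<le> V (u 0)" using ge[of 0] \<open>0 < c\<close> by simp
        then show False using lin[of "V (u 0) / \<eta>"] ge[of "V (u 0) / \<eta>"] \<open>0 < c\<close> \<open>\<eta> > 0\<close>
          by simp
      qed
      show ?thesis
        unfolding tendsto_iff
      proof (intro allI impI)
        fix e :: real assume "e > 0"
        \<comment> \<open>\<open>V\<close> has a positive lower bound on this shell; once
          \<open>V\<close> is below it, monotonicity forbids a return to the shell. If the shell is
          empty, the bound 1 is arbitrary.\<close>
        define S where "S = cball 0 r - ball (0::'a) e"
        have "\<exists>c>0. \<forall>z\<in>S. c \<le> V z"
        proof (cases "S = {}")
          case False
          then have "\<exists>z\<in>S. \<forall>w\<in>S. V z \<le> V w" unfolding S_def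
            by (intro continuous_attains_inf continuous_on_subset[OF contV] compact_diff) auto
          then obtain z where z: "z \<in> S" "\<And>w. w \<in> S \<Longrightarrow> V z \<le> V w" by blast
          have "0 < V z" using z(1) \<open>e > 0\<close> by (intro pos) (auto simp: S_def)
          then show ?thesis using z by blast
        qed (auto intro: exI[of _ 1])
        then obtain c where c: "c > 0" "\<And>z. z \<in> S \<Longrightarrow> c \<le> V z" by blast
        obtain t0 where t0: "0 \<le> t0" "V (u t0) < c" using small[OF c(1)] by blast
        have "dist (u t) 0 < e" if "t0 \<le> t" for t
        proof (rule ccontr)
          assume "\<not> dist (u t) 0 < e"
          then have "u t \<in> S" using ub[of t] t0 that by (simp add: S_def)
          then show False using c(2) mono[OF t0(1) that] t0(2) by fastforce
        qed
        then show "\<forall>\<^sub>F t in at_top. dist (u t) 0 < e"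
          unfolding eventually_at_top_linorder by blast
      qed
    qed
    then show ?thesis unfolding locally_attractive_def using \<delta>
      by (intro exI[of _ \<delta>]) auto
  qed
  ultimately show ?thesis using f0 by (simp add: asymptotically_stable_equilibrium_def)
qed

section \<open>The corrector\<close>

lemma abs_sum_mult_le:
  fixes c t :: "'b \<Rightarrow> real"
  assumes "\<And>j. j \<in> A \<Longrightarrow> \<bar>t j\<bar> \<le> B"
  shows "\<bar>\<Sum>j\<in>A. c j * t j\<bar> \<le> (\<Sum>j\<in>A. \<bar>c j\<bar>) * B"
proof -
  have "\<bar>\<Sum>j\<in>A. c j * t j\<bar> \<le> (\<Sum>j\<in>A. \<bar>c j\<bar> * \<bar>t j\<bar>)"
    using sum_abs[of "\<lambda>j. c j * t j" A] by (simp add: abs_mult)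
  also have "\<dots> \<le> (\<Sum>j\<in>A. \<bar>c j\<bar> * B)"
    using assms by (intro sum_mono mult_left_mono) auto
  finally show ?thesis by (simp add: sum_distrib_right)
qed

text \<open>A Young-type inequality with constant 1: the larger of \<open>a\<close> and
  \<open>b ^ q\<close> replaces the other, and \<open>b \<le> 1\<close> lets the resulting exponent
  \<open>Suc n * q\<close> be lowered to \<open>M\<close>.\<close>

lemma power_mult_power_le_add:
  fixes a b :: real
  assumes "0 \<le> a" "0 \<le> b" "b \<le> 1" "M \<le> Suc n * q"
  shows "a ^ n * b ^ q \<le> a ^ Suc n + b ^ M"
proof (cases "b ^ q \<le> a")
  case True
  then have "a ^ n * b ^ q \<le> a ^ n * a" using assms by (intro mult_left_mono) auto
  also have "\<dots> \<le> a ^ Suc n + b ^ M" using assms by (simp add: mult.commute)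
  finally show ?thesis .
next
  case False
  then have "a ^ n * b ^ q \<le> (b ^ q) ^ n * b ^ q"
    using assms by (intro mult_right_mono power_mono) auto
  also have "\<dots> = b ^ (Suc n * q)" by (simp add: power_add power_mult[symmetric] mult.commute)
  also have "\<dots> \<le> b ^ M" using assms by (intro power_decreasing) auto
  also have "\<dots> \<le> a ^ Suc n + b ^ M" using assms by simp
  finally show ?thesis .
qed

text \<open>The recursion hidden in the product,
  \<open>(2*j*l+1) * c (Suc j) = (2*(k-j)+1) * c j\<close> for \<open>j \<le> k\<close>, makes the
  x-derivative of monomial \<open>j\<close> of the corrector cancel the y-derivative of monomial
  \<open>j+1\<close> along the Hamiltonian field.\<close>

definition corrector_coeff :: "nat \<Rightarrow> nat \<Rightarrow> nat \<Rightarrow> real" where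
  "corrector_coeff k l j = (\<Prod>i<j. real (2 * (k - i) + 1) / real (2 * i * l + 1))"

text \<open>This is the polynomial \<open>W\<close> of the introduction. With weight
  \<open>l\<close> for \<open>x\<close> and 1 for \<open>y\<close> it is quasi-homogeneous of weight
  \<open>2*k*l+l+1\<close>.\<close>

definition corrector :: "nat \<Rightarrow> nat \<Rightarrow> real \<Rightarrow> real \<Rightarrow> real" where
  "corrector k l x y = (\<Sum>j\<le>k. corrector_coeff k l j / real (2 * j * l + 1) *
     (x ^ (2 * (k - j) + 1) * y ^ (2 * j * l + 1)))"

definition corrector_dx :: "nat \<Rightarrow> nat \<Rightarrow> real \<Rightarrow> real \<Rightarrow> real" where
  "corrector_dx k l x y = (\<Sum>j\<le>k. corrector_coeff k l (Suc j) * (x ^ (2 * (k - j)) * y ^ (2 * j * l + 1)))"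

definition corrector_dy :: "nat \<Rightarrow> nat \<Rightarrow> real \<Rightarrow> real \<Rightarrow> real" where
  "corrector_dy k l x y = (\<Sum>j\<le>k. corrector_coeff k l j * (x ^ (2 * (k - j) + 1) * y ^ (2 * j * l)))"

text \<open>The numerators are the factors of the double factorial in reverse order, hence the
  reindexing by \<open>k - i\<close>; the denominators form the factorial of step
  \<open>2*l\<close>.\<close>

lemma corrector_coeff_last:
  assumes "1 \<le> l"
  shows "corrector_coeff k l (Suc k) = m_star k l"
proof -
  have "(\<Prod>i<Suc k. real (2 * (k - i) + 1)) = (\<Prod>i=0..k. real (2 * i + 1))"
    by (rule prod.reindex_bij_witness[of _ "\<lambda>i. k - i" "\<lambda>i. k - i"]) auto
  moreover have "(\<Prod>i<Suc k. real (2 * i * l + 1)) = (\<Prod>i=0..k. real (i * (2 * l) + 1))"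
    by (intro prod.cong) (auto simp: ac_simps)
  ultimately show ?thesis
    using multifactorial_eq_prod[of 2 k] multifactorial_eq_prod[of "2 * l" k] assms
    by (simp add: corrector_coeff_def m_star_def prod_dividef ac_simps del: prod.lessThan_Suc)
qed

lemma has_derivative_corrector:
  "((\<lambda>z. corrector k l (fst z) (snd z)) has_derivative
     (\<lambda>h. corrector_dx k l (fst z) (snd z) * fst h + corrector_dy k l (fst z) (snd z) * snd h)) (at z)"
proof -
  have "((\<lambda>z. c / real (2 * j * l + 1) * (fst z ^ (2 * (k - j) + 1) * snd z ^ (2 * j * l + 1))) has_derivative
     (\<lambda>h. c * real (2 * (k - j) + 1) / real (2 * j * l + 1) * (fst z ^ (2 * (k - j)) * snd z ^ (2 * j * l + 1)) * fst h
        + c * (fst z ^ (2 * (k - j) + 1) * snd z ^ (2 * j * l)) * snd h)) (at z)"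
    (is "(_ has_derivative ?D) _") for c j
  proof -
    have "((\<lambda>z. c / real (2 * j * l + 1) * (fst z ^ (2 * (k - j) + 1) * snd z ^ (2 * j * l + 1))) has_derivative
      (\<lambda>h. c / real (2 * j * l + 1) * (fst z ^ (2 * (k - j) + 1) * (real (2 * j * l + 1) * snd h * snd z ^ (2 * j * l))
        + real (2 * (k - j) + 1) * fst h * fst z ^ (2 * (k - j)) * snd z ^ (2 * j * l + 1)))) (at z)"
      by (rule derivative_eq_intros refl | simp add: field_simps)+
    moreover have "(\<lambda>h. c / real (2 * j * l + 1) * (fst z ^ (2 * (k - j) + 1) * (real (2 * j * l + 1) * snd h * snd z ^ (2 * j * l))
        + real (2 * (k - j) + 1) * fst h * fst z ^ (2 * (k - j)) * snd z ^ (2 * j * l + 1))) = ?D"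
    proof -
      have nz: "real (2 * j * l + 1) \<noteq> 0" by (subst of_nat_eq_0_iff) simp
      have *: "c / r * (p * (r * w * q) + n * v * p' * q') = c * n / r * (p' * q') * v + c * (p * q) * w"
        if "r \<noteq> 0" for p q r n v p' q' w :: real
        using that by (simp add: field_simps)
      show ?thesis
        by (intro ext *) (rule nz)
    qed
    ultimately show ?thesis by simp
  qed
  then have "((\<lambda>z. corrector k l (fst z) (snd z)) has_derivative
    (\<lambda>h. \<Sum>j\<le>k. corrector_coeff k l j * real (2 * (k - j) + 1) / real (2 * j * l + 1) * (fst z ^ (2 * (k - j)) * snd z ^ (2 * j * l + 1)) * fst h
        + corrector_coeff k l j * (fst z ^ (2 * (k - j) + 1) * snd z ^ (2 * j * l)) * snd h)) (at z)"
    unfolding corrector_def by (intro has_derivative_sum)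
  \<comment> \<open>Differentiating in \<open>x\<close> brings out
    \<open>(2*(k-j)+1) / (2*j*l+1)\<close>, exactly the next factor of the product, which turns
    coefficient \<open>j\<close> into coefficient \<open>Suc j\<close>.\<close>
  then show ?thesis
    unfolding corrector_dx_def corrector_dy_def sum_distrib_right sum.distrib[symmetric]
    by (simp add: corrector_coeff_def mult.assoc)
qed

text \<open>The derivative of \<^term>\<open>corrector k l\<close> along the Hamiltonian field \<open>(y ^ (2 * l - 1), - x)\<close> telescopes.\<close>
lemma corrector_hamiltonian_derivative:
  assumes "1 \<le> l"
  shows "corrector_dx k l x y * y ^ (2 * l - 1) - corrector_dy k l x y * x
    = m_star k l * y ^ (2 * l * (k + 1)) - x ^ (2 * k + 2)"
proof -
  \<comment> \<open>Both sums consist of these monomials: the one from \<open>corrector_dx\<close>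
    gives \<open>P (Suc j)\<close>, the one from \<open>corrector_dy\<close> gives
    \<open>P j\<close>, so only \<open>P (Suc k)\<close> and \<open>P 0\<close> survive in the
    difference.\<close>
  define P where "P j = corrector_coeff k l j * (x ^ (2 * (Suc k - j)) * y ^ (2 * j * l))" for j
  have "corrector_dx k l x y * y ^ (2 * l - 1) = (\<Sum>j\<le>k. P (Suc j))"
    unfolding corrector_dx_def sum_distrib_right
  proof (intro sum.cong refl)
    fix j assume "j \<in> {..k}"
    have "y ^ (2 * j * l + 1) * y ^ (2 * l - 1) = y ^ (2 * Suc j * l)"
      using assms by (simp add: power_add[symmetric] del: power_Suc) (simp add: algebra_simps)
    then show "corrector_coeff k l (Suc j) * (x ^ (2 * (k - j)) * y ^ (2 * j * l + 1)) * y ^ (2 * l - 1)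
        = P (Suc j)"
      unfolding P_def by (simp only: mult.assoc diff_Suc_Suc)
  qed
  moreover have "corrector_dy k l x y * x = (\<Sum>j\<le>k. P j)"
    unfolding corrector_dy_def sum_distrib_right
  proof (intro sum.cong refl)
    fix j assume "j \<in> {..k}"
    then have "2 * (Suc k - j) = Suc (2 * (k - j) + 1)" by auto
    then show "corrector_coeff k l j * (x ^ (2 * (k - j) + 1) * y ^ (2 * j * l)) * x = P j"
      unfolding P_def by (simp only: power_Suc ac_simps)
  qed
  moreover have "(\<Sum>j\<le>k. P (Suc j)) - (\<Sum>j\<le>k. P j) = P (Suc k) - P 0"
    unfolding sum_subtractf[symmetric]
    using sum_telescope[of P k] sum_negf[of "\<lambda>j. P j - P (Suc j)" "{..k}"] by simp
  moreover have "P (Suc k) = m_star k l * y ^ (2 * l * (k + 1))"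
    unfolding P_def corrector_coeff_last[OF assms] by (simp add: algebra_simps)
  moreover have "P 0 = x ^ (2 * k + 2)" by (simp add: P_def corrector_coeff_def)
  ultimately show ?thesis by simp
qed

text \<open>Keeps \<open>H - \<theta> W\<close> positive definite near 0. One factor
  \<open>y\<close> of each monomial supplies \<open>r\<close>; the rest has \<open>x\<close>-degree
  at least 2, except for \<open>j = k\<close>, where the Young-type inequality applies.\<close>

lemma corrector_le:
  assumes k: "1 \<le> k" and l: "1 \<le> l"
  obtains C where "0 \<le> C"
    "\<And>x y r. \<bar>x\<bar> \<le> r \<Longrightarrow> \<bar>y\<bar> \<le> r \<Longrightarrow> r \<le> 1 \<Longrightarrow> \<bar>corrector k l x y\<bar> \<le> C * (r * (x ^ 2 + y ^ (2 * l)))"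
proof
  let ?C = "\<Sum>j\<le>k. \<bar>corrector_coeff k l j / real (2 * j * l + 1)\<bar>"
  show "0 \<le> ?C" by (intro sum_nonneg) auto
  fix x y r :: real
  assume r: "\<bar>x\<bar> \<le> r" "\<bar>y\<bar> \<le> r" "r \<le> 1"
  define a b where "a = \<bar>x\<bar>" and "b = \<bar>y\<bar>"
  have ab: "0 \<le> a" "0 \<le> b" "a \<le> 1" "b \<le> 1" "b \<le> r" using r by (auto simp: a_def b_def)
  have E: "a ^ 2 + b ^ (2 * l) = x ^ 2 + y ^ (2 * l)"
    by (simp add: a_def b_def power_mult)
  have "\<bar>x ^ (2 * (k - j) + 1) * y ^ (2 * j * l + 1)\<bar> \<le> r * (x ^ 2 + y ^ (2 * l))"
    if "j \<in> {..k}" for j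
  proof -
    have "a ^ (2 * (k - j) + 1) * b ^ (2 * j * l) \<le> a ^ 2 + b ^ (2 * l)"
    proof (cases "j = k")
      case True
      have "2 * l \<le> Suc 1 * (2 * k * l)" using k by simp
      then show ?thesis
        using power_mult_power_le_add[of a b "2 * l" 1 "2 * k * l"] ab True by (simp add: power2_eq_square)
    next
      case False
      with that have "2 \<le> 2 * (k - j) + 1" by auto
      then have "a ^ (2 * (k - j) + 1) * b ^ (2 * j * l) \<le> a ^ 2 * 1"
        using ab by (intro mult_mono power_decreasing power_le_one) auto
      then show ?thesis using ab by (simp add: add_increasing2)
    qed
    then have "b * (a ^ (2 * (k - j) + 1) * b ^ (2 * j * l)) \<le> r * (a ^ 2 + b ^ (2 * l))"
      using ab by (intro mult_mono) auto
    then show ?thesis unfolding E by (simp add: abs_mult power_abs a_def b_def ac_simps)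
  qed
  from abs_sum_mult_le[of "{..k}", OF this]
  show "\<bar>corrector k l x y\<bar> \<le> ?C * (r * (x ^ 2 + y ^ (2 * l)))"
    unfolding corrector_def .
qed

text \<open>Up to sign, the bounded quantity is the derivative of the corrector along the remaining
  field \<open>(- x ^ (2*k+1), m * y ^ (2*s+1))\<close>. Again one factor \<open>y\<close> supplies
  \<open>r\<close>, and what is left is compared with the definite leading form.\<close>

lemma corrector_perturbation_le:
  assumes k: "1 \<le> k" and l: "1 \<le> l" and ls: "l \<le> 2 * s" and N: "N \<le> s" "N \<le> k * l"
  obtains C where "0 \<le> C"
    "\<And>x y r. \<bar>x\<bar> \<le> r \<Longrightarrow> \<bar>y\<bar> \<le> r \<Longrightarrow> r \<le> 1 \<Longrightarrow>
      \<bar>corrector_dx k l x y * x ^ (2 * k + 1) - m * (corrector_dy k l x y * y ^ (2 * s + 1))\<bar>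
        \<le> C * (r * (x ^ (2 * k + 2) + y ^ (2 * l + 2 * N)))"
proof
  let ?C1 = "\<Sum>j\<le>k. \<bar>corrector_coeff k l (Suc j)\<bar>" and ?C2 = "\<Sum>j\<le>k. \<bar>corrector_coeff k l j\<bar>"
  show "0 \<le> ?C1 + \<bar>m\<bar> * ?C2" by (intro add_nonneg_nonneg mult_nonneg_nonneg sum_nonneg) auto
  fix x y r :: real
  assume r: "\<bar>x\<bar> \<le> r" "\<bar>y\<bar> \<le> r" "r \<le> 1"
  define a b where "a = \<bar>x\<bar>" and "b = \<bar>y\<bar>"
  define E where "E = x ^ (2 * k + 2) + y ^ (2 * l + 2 * N)"
  have ab: "0 \<le> a" "0 \<le> b" "a \<le> 1" "b \<le> 1" "b \<le> r" using r by (auto simp: a_def b_def)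
  have E: "E = a ^ (2 * k + 2) + b ^ (2 * l + 2 * N)"
    unfolding E_def a_def b_def by (subst (1 2) power_even_abs) auto
  have E_ge: "a ^ (2 * k + 2) \<le> E" "b ^ (2 * l + 2 * N) \<le> E" using ab unfolding E by auto
  have step: "\<bar>x ^ p * y ^ (q + 1)\<bar> \<le> r * E" if "a ^ p * b ^ q \<le> E" for p q
  proof -
    have "b * (a ^ p * b ^ q) \<le> r * E" using that ab by (intro mult_mono) auto
    then show ?thesis by (simp add: abs_mult power_abs a_def b_def ac_simps)
  qed
  have young: "a ^ (2 * k + 1) * b ^ q \<le> E" if "2 * l + 2 * N \<le> (2 * k + 2) * q" for q
    using power_mult_power_le_add[of a b "2 * l + 2 * N" "2 * k + 1" q] ab that unfolding E by simp
  have kl: "l \<le> k * l" using k by simp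
  have *: "\<bar>x ^ (2 * (k - j) + (2 * k + 1)) * y ^ (2 * j * l + 1)\<bar> \<le> r * E" if "j \<in> {..k}" for j
  \<comment> \<open>Only \<open>j = k\<close> lacks a full factor \<open>x ^ (2*k+2)\<close>; there
    \<open>x\<close> has degree \<open>2*k+1\<close>, just what \<open>young\<close> needs.\<close>
  proof (rule step, cases "j = k")
    case True
    have "2 * l + 2 * N \<le> 2 * (2 * k * l)" using kl N mult.assoc[of 2 k l] by linarith
    also have "\<dots> \<le> (2 * k + 2) * (2 * k * l)" by (intro mult_right_mono) auto
    finally show "a ^ (2 * (k - j) + (2 * k + 1)) * b ^ (2 * j * l) \<le> E"
      using young[of "2 * k * l"] True by simp
  next
    case False
    with that have "2 * k + 2 \<le> 2 * (k - j) + (2 * k + 1)" by auto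
    then have "a ^ (2 * (k - j) + (2 * k + 1)) * b ^ (2 * j * l) \<le> a ^ (2 * k + 2) * 1"
      using ab by (intro mult_mono power_decreasing power_le_one) auto
    then show "a ^ (2 * (k - j) + (2 * k + 1)) * b ^ (2 * j * l) \<le> E" using E_ge by simp
  qed
  have **: "\<bar>x ^ (2 * (k - j) + 1) * y ^ (2 * j * l + 2 * s + 1)\<bar> \<le> r * E" if "j \<in> {..k}" for j
  \<comment> \<open>For \<open>j = 0\<close> the power of \<open>y\<close> is only
    \<open>2*s\<close> after one factor is split off; here \<open>l \<le> 2*s\<close> enters, with
    \<open>N \<le> s\<close>, to meet the requirement of \<open>young\<close>. For
    \<open>j > 0\<close> the power of \<open>y\<close> alone suffices.\<close>
  proof (rule step, cases "j = 0")
    case True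
    have "2 * l + 2 * N \<le> 4 * (2 * s)" using ls N by simp
    also have "\<dots> \<le> (2 * k + 2) * (2 * s)" using k by (intro mult_right_mono) auto
    finally show "a ^ (2 * (k - j) + 1) * b ^ (2 * j * l + 2 * s) \<le> E"
      using young[of "2 * s"] True by simp
  next
    case False
    then have "2 * l + 2 * N \<le> 2 * j * l + 2 * s" using N by (intro add_mono) auto
    then have "a ^ (2 * (k - j) + 1) * b ^ (2 * j * l + 2 * s) \<le> 1 * b ^ (2 * l + 2 * N)"
      using ab by (intro mult_mono power_decreasing power_le_one) auto
    then show "a ^ (2 * (k - j) + 1) * b ^ (2 * j * l + 2 * s) \<le> E" using E_ge by simp
  qed
  have "corrector_dx k l x y * x ^ (2 * k + 1)
      = (\<Sum>j\<le>k. corrector_coeff k l (Suc j) * (x ^ (2 * (k - j) + (2 * k + 1)) * y ^ (2 * j * l + 1)))"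
    unfolding corrector_dx_def sum_distrib_right power_add by (simp add: ac_simps)
  then have 1: "\<bar>corrector_dx k l x y * x ^ (2 * k + 1)\<bar> \<le> ?C1 * (r * E)"
    using abs_sum_mult_le[of "{..k}", OF *] by simp
  have "corrector_dy k l x y * y ^ (2 * s + 1)
      = (\<Sum>j\<le>k. corrector_coeff k l j * (x ^ (2 * (k - j) + 1) * y ^ (2 * j * l + 2 * s + 1)))"
    unfolding corrector_dy_def sum_distrib_right power_add by (simp add: ac_simps)
  then have 2: "\<bar>corrector_dy k l x y * y ^ (2 * s + 1)\<bar> \<le> ?C2 * (r * E)"
    using abs_sum_mult_le[of "{..k}", OF **] by simp
  have "\<bar>corrector_dx k l x y * x ^ (2 * k + 1) - m * (corrector_dy k l x y * y ^ (2 * s + 1))\<bar>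
      \<le> \<bar>corrector_dx k l x y * x ^ (2 * k + 1)\<bar> + \<bar>m\<bar> * \<bar>corrector_dy k l x y * y ^ (2 * s + 1)\<bar>"
    unfolding abs_mult[symmetric] by (rule abs_triangle_ineq4)
  also have "\<dots> \<le> ?C1 * (r * E) + \<bar>m\<bar> * (?C2 * (r * E))"
    using 1 2 by (intro add_mono mult_left_mono) auto
  finally show "\<bar>corrector_dx k l x y * x ^ (2 * k + 1) - m * (corrector_dy k l x y * y ^ (2 * s + 1))\<bar>
        \<le> (?C1 + \<bar>m\<bar> * ?C2) * (r * (x ^ (2 * k + 2) + y ^ (2 * l + 2 * N)))"
    unfolding E_def[symmetric] by (simp add: algebra_simps)
qed

section \<open>Stability of the planar system\<close>

lemma planar_system_lipschitz:
  "\<exists>L. L-lipschitz_on (cball 0 1) (planar_system k l s m)"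
proof (intro exI lipschitz_onI)
  let ?L = "real (2 * l - 1) + real (2 * k + 1) + (1 + \<bar>m\<bar> * real (2 * s + 1))"
  fix z w :: "real \<times> real"
  assume zw: "z \<in> cball 0 1" "w \<in> cball 0 1"
  obtain x y x' y' where z: "z = (x, y)" and w: "w = (x', y')" by fastforce
  have le1: "norm x \<le> 1" "norm y \<le> 1" "norm x' \<le> 1" "norm y' \<le> 1"
    using zw norm_fst_le[of x y] norm_snd_le[of y x] norm_fst_le[of x' y'] norm_snd_le[of y' x']
    unfolding z w by auto
  define d where "d = dist z w"
  have d: "\<bar>x - x'\<bar> \<le> d" "\<bar>y - y'\<bar> \<le> d"
    using dist_fst_le[of z w] dist_snd_le[of z w] by (simp_all add: d_def z w dist_real_def)
  have px: "\<bar>x ^ n - x' ^ n\<bar> \<le> real n * d" for n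
    using norm_power_diff[OF le1(1,3), of n] mult_left_mono[OF d(1), of "real n"] by simp
  have py: "\<bar>y ^ n - y' ^ n\<bar> \<le> real n * d" for n
    using norm_power_diff[OF le1(2,4), of n] mult_left_mono[OF d(2), of "real n"] by simp
  have "dist (planar_system k l s m z) (planar_system k l s m w)
      \<le> \<bar>(y ^ (2 * l - 1) - y' ^ (2 * l - 1)) - (x ^ (2 * k + 1) - x' ^ (2 * k + 1))\<bar>
        + \<bar>(x' - x) + m * (y ^ (2 * s + 1) - y' ^ (2 * s + 1))\<bar>"
    unfolding planar_system_def z w dist_norm
    by (simp only: case_prod_conv diff_Pair, rule order_trans[OF norm_Pair_le])
       (simp add: algebra_simps)
  also have "\<dots> \<le> (\<bar>y ^ (2 * l - 1) - y' ^ (2 * l - 1)\<bar> + \<bar>x ^ (2 * k + 1) - x' ^ (2 * k + 1)\<bar>)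
        + (\<bar>x' - x\<bar> + \<bar>m\<bar> * \<bar>y ^ (2 * s + 1) - y' ^ (2 * s + 1)\<bar>)"
    unfolding abs_mult[symmetric] by (intro add_mono abs_triangle_ineq abs_triangle_ineq4)
  also have "\<dots> \<le> (real (2 * l - 1) * d + real (2 * k + 1) * d)
        + (d + \<bar>m\<bar> * (real (2 * s + 1) * d))"
    using d by (intro add_mono px py mult_left_mono) auto
  also have "\<dots> = ?L * d" by (simp add: algebra_simps)
  finally show "dist (planar_system k l s m z) (planar_system k l s m w) \<le> ?L * dist z w"
    unfolding d_def .
qed simp

lemma ex_small_radius:
  fixes A a :: real
  assumes "0 \<le> A" "0 < a"
  shows "\<exists>\<rho>>0. \<forall>r\<in>{0..\<rho>}. A * r < a"
proof (intro exI conjI ballI)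
  show "0 < a / (A + 1)" using assms by simp
  fix r assume "r \<in> {0..a / (A + 1)}"
  then have "A * r \<le> A * (a / (A + 1))" using assms by (intro mult_left_mono) auto
  also have "\<dots> < a" using assms by (simp add: field_simps)
  finally show "A * r < a" .
qed

text \<open>
  \<open>\<sigma>\<close> is the direction of time and \<open>\<theta>\<close> a free parameter: along the system, the derivative of
  \<open>x\<^sup>2 / 2 + y ^ (2 * l) / (2 * l) - \<theta> * corrector k l x y\<close> is, to leading order,
  \<open>(\<theta> - 1) * x ^ (2 * k + 2) + \<beta> * y ^ (2 * l + 2 * N)\<close>.
\<close>
lemma planar_system_asymptotically_stable:
  fixes m \<theta> \<beta> \<sigma> :: real
  assumes k: "1 \<le> k" and l: "1 \<le> l" and ls: "l \<le> 2 * s" and N: "N \<le> s" "N \<le> k * l"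
    and \<sigma>: "\<bar>\<sigma>\<bar> = 1" "\<sigma> * (\<theta> - 1) < 0" "\<sigma> * \<beta> < 0" and C0: "0 \<le> C0"
    and rem: "\<And>y. \<bar>y\<bar> \<le> 1 \<Longrightarrow>
      \<bar>m * y ^ (2 * l + 2 * s) - \<theta> * (m_star k l * y ^ (2 * l * (k + 1))) - \<beta> * y ^ (2 * l + 2 * N)\<bar>
        \<le> C0 * (\<bar>y\<bar> * y ^ (2 * l + 2 * N))"
  shows "asymptotically_stable_equilibrium (\<lambda>z. \<sigma> *\<^sub>R planar_system k l s m z) (0, 0)"
proof -
  obtain C1 where C1: "0 \<le> C1" "\<And>x y r. \<bar>x\<bar> \<le> r \<Longrightarrow> \<bar>y\<bar> \<le> r \<Longrightarrow> r \<le> 1 \<Longrightarrow>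
      \<bar>corrector k l x y\<bar> \<le> C1 * (r * (x ^ 2 + y ^ (2 * l)))"
    using corrector_le[OF k l] by blast
  obtain C2 where C2: "0 \<le> C2" "\<And>x y r. \<bar>x\<bar> \<le> r \<Longrightarrow> \<bar>y\<bar> \<le> r \<Longrightarrow> r \<le> 1 \<Longrightarrow>
      \<bar>corrector_dx k l x y * x ^ (2 * k + 1) - m * (corrector_dy k l x y * y ^ (2 * s + 1))\<bar>
        \<le> C2 * (r * (x ^ (2 * k + 2) + y ^ (2 * l + 2 * N)))"
    using corrector_perturbation_le[OF k l ls N] by blast
  \<comment> \<open>The margin by which both leading coefficients are negative in the chosen time
    direction; the errors must stay below it.\<close>
  define c where "c = min (- (\<sigma> * (\<theta> - 1))) (- (\<sigma> * \<beta>))"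
  have c: "0 < c" "\<sigma> * (\<theta> - 1) \<le> - c" "\<sigma> * \<beta> \<le> - c" using \<sigma> by (auto simp: c_def)
  \<comment> \<open>\<open>A\<close> measures the corrector inside \<open>V\<close>, and
    \<open>B\<close> collects the errors in the derivative: \<open>C0\<close> from the pure powers
    of \<open>y\<close> and \<open>C2\<close> from the perturbation of the corrector.\<close>
  define A where "A = \<bar>\<theta>\<bar> * C1"
  define B where "B = C0 + \<bar>\<theta>\<bar> * C2"
  have AB: "0 \<le> A" "0 \<le> B" using C1 C2 C0 by (auto simp: A_def B_def)
  \<comment> \<open>The threshold \<open>1 / (2 * real l)\<close> is the smaller of the two
    coefficients of the Hamiltonian, since \<open>1 \<le> l\<close>.\<close>
  obtain \<rho>1 where \<rho>1: "0 < \<rho>1" "\<And>r. r \<in> {0..\<rho>1} \<Longrightarrow> A * r < 1 / (2 * real l)"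
    using ex_small_radius[OF AB(1), of "1 / (2 * real l)"] l by auto
  obtain \<rho>2 where \<rho>2: "0 < \<rho>2" "\<And>r. r \<in> {0..\<rho>2} \<Longrightarrow> B * r < c"
    using ex_small_radius[OF AB(2) c(1)] by auto
  define \<rho> where "\<rho> = min 1 (min \<rho>1 \<rho>2)"
  have \<rho>: "0 < \<rho>" "\<rho> \<le> 1" using \<rho>1 \<rho>2 by (auto simp: \<rho>_def)
  obtain L where L: "L-lipschitz_on (cball 0 1) (planar_system k l s m)"
    using planar_system_lipschitz by blast
  define V where "V z = (fst z)\<^sup>2 / 2 + snd z ^ (2 * l) / (2 * real l)
      - \<theta> * corrector k l (fst z) (snd z)" for z :: "real \<times> real"
  define V' where "V' z h = (fst z - \<theta> * corrector_dx k l (fst z) (snd z)) * fst h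
      + (snd z ^ (2 * l - 1) - \<theta> * corrector_dy k l (fst z) (snd z)) * snd h" for z h :: "real \<times> real"
  have box: "\<bar>x\<bar> \<le> norm (x, y)" "\<bar>y\<bar> \<le> norm (x, y)" for x y :: real
    using norm_fst_le[of x y] norm_snd_le[of y x] by auto
  \<comment> \<open>The Hamiltonian contributes \<open>- x ^ (2*k+2)\<close> and the term in
    \<open>m\<close>; the telescoped derivative of the corrector adds
    \<open>\<theta> * x ^ (2*k+2)\<close> and the term in \<open>m_star\<close>; the last summand is
    the higher-order part.\<close>
  have V'_planar: "V' (x, y) (planar_system k l s m (x, y)) =
      (\<theta> - 1) * x ^ (2 * k + 2)
      + (m * y ^ (2 * l + 2 * s) - \<theta> * (m_star k l * y ^ (2 * l * (k + 1))))
      + \<theta> * (corrector_dx k l x y * x ^ (2 * k + 1) - m * (corrector_dy k l x y * y ^ (2 * s + 1)))" for x y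
  proof -
    have e: "x * x ^ (2 * k + 1) = x ^ (2 * k + 2)" by simp
    have e': "y ^ (2 * l - 1) * y ^ (2 * s + 1) = y ^ (2 * l + 2 * s)"
      using l by (simp add: power_add[symmetric] del: power_Suc)
    have "V' (x, y) (planar_system k l s m (x, y)) =
        - (x * x ^ (2 * k + 1)) + m * (y ^ (2 * l - 1) * y ^ (2 * s + 1))
        - \<theta> * (corrector_dx k l x y * y ^ (2 * l - 1) - corrector_dy k l x y * x)
        + \<theta> * (corrector_dx k l x y * x ^ (2 * k + 1) - m * (corrector_dy k l x y * y ^ (2 * s + 1)))"
      unfolding V'_def planar_system_def by (simp add: algebra_simps del: power_Suc)
    then show ?thesis
      unfolding corrector_hamiltonian_derivative[OF l] e e' by (simp add: algebra_simps del: power_Suc)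
  qed
  have "asymptotically_stable_equilibrium (\<lambda>z. \<sigma> *\<^sub>R planar_system k l s m z) 0"
  proof (rule lyapunov_asymptotically_stable[where r = \<rho> and L = L and V = V and V' = V'])
    show "L-lipschitz_on (cball 0 \<rho>) (\<lambda>z. \<sigma> *\<^sub>R planar_system k l s m z)"
    proof (rule lipschitz_onI)
      fix z w :: "real \<times> real" assume "z \<in> cball 0 \<rho>" "w \<in> cball 0 \<rho>"
      then show "dist (\<sigma> *\<^sub>R planar_system k l s m z) (\<sigma> *\<^sub>R planar_system k l s m w) \<le> L * dist z w"
        using lipschitz_onD[OF L, of z w] \<rho> \<sigma>(1)
        by (simp add: dist_norm scaleR_diff_right[symmetric])
    qed (rule lipschitz_on_nonneg[OF L])
    show "\<sigma> *\<^sub>R planar_system k l s m 0 = 0"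
      using l by (simp add: planar_system_def zero_prod_def)
    show "(V has_derivative V' z) (at z)" for z
    proof -
      have "((\<lambda>z. (fst z)\<^sup>2 / 2 + snd z ^ (2 * l) / (2 * real l)) has_derivative
          (\<lambda>h. fst z * fst h + snd z ^ (2 * l - 1) * snd h)) (at z)"
        by (rule derivative_eq_intros refl | use l in \<open>simp add: field_simps\<close>)+
      from has_derivative_diff[OF this has_derivative_mult_right[OF has_derivative_corrector, of \<theta>]]
      show ?thesis unfolding V_def[abs_def] V'_def[abs_def] by (simp add: algebra_simps)
    qed
    show "V 0 = 0" using l by (simp add: V_def corrector_def)
    show "continuous_on (cball 0 \<rho>) (\<lambda>z. V' z (\<sigma> *\<^sub>R planar_system k l s m z))"
      unfolding V'_def planar_system_def corrector_dx_def corrector_dy_def split_beta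
      by (auto intro!: continuous_intros)
    fix z :: "real \<times> real" assume z: "z \<in> cball 0 \<rho>" "z \<noteq> 0"
    obtain x y where xy: "z = (x, y)" by fastforce
    define r where "r = norm z"
    have r: "0 \<le> r" "r \<le> 1" "r \<in> {0..\<rho>1}" "r \<in> {0..\<rho>2}" "\<bar>x\<bar> \<le> r" "\<bar>y\<bar> \<le> r"
      using z(1) box(1)[of x y] box(2)[of y x] by (auto simp: r_def \<rho>_def xy)
    have even_pos: "0 < x ^ (2 * i) + y ^ (2 * j)" if "0 < i" "0 < j" for i j
      using z(2) that by (auto simp: xy zero_prod_def power_mult add_pos_nonneg add_nonneg_pos)
    show "0 < V z"
    proof -
      define Q where "Q = x ^ 2 + y ^ (2 * l)"
      have Q: "0 < Q" using even_pos[of 1 l] l by (simp add: Q_def)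
      have "\<bar>\<theta> * corrector k l x y\<bar> \<le> A * r * Q"
        using mult_left_mono[OF C1(2)[OF r(5,6,2)], of "\<bar>\<theta>\<bar>"]
        by (simp add: abs_mult A_def Q_def ac_simps)
      also have "\<dots> < 1 / (2 * real l) * Q"
        using \<rho>1(2)[OF r(3)] Q by (intro mult_strict_right_mono) auto
      also have "\<dots> \<le> x\<^sup>2 / 2 + y ^ (2 * l) / (2 * real l)"
      proof -
        have "x\<^sup>2 / (2 * real l) \<le> x\<^sup>2 / 2" using l by (intro divide_left_mono) auto
        then show ?thesis by (simp add: Q_def add_divide_distrib)
      qed
      finally show ?thesis by (simp add: V_def xy)
    qed
    show "V' z (\<sigma> *\<^sub>R planar_system k l s m z) < 0"
    proof -
      define X where "X = x ^ (2 * k + 2)"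
      define Y where "Y = y ^ (2 * l + 2 * N)"
      define R1 where "R1 = m * y ^ (2 * l + 2 * s) - \<theta> * (m_star k l * y ^ (2 * l * (k + 1))) - \<beta> * Y"
      define R2 where "R2 = corrector_dx k l x y * x ^ (2 * k + 1) - m * (corrector_dy k l x y * y ^ (2 * s + 1))"
      have "0 \<le> X" "0 \<le> Y" unfolding X_def Y_def by (rule zero_le_even_power, simp)+
      moreover have "0 < X + Y" using even_pos[of "k + 1" "l + N"] l by (simp add: X_def Y_def)
      ultimately have XY: "0 \<le> X" "0 \<le> Y" "0 < X + Y" .
      have "\<bar>R1\<bar> \<le> C0 * (\<bar>y\<bar> * Y)" unfolding R1_def Y_def using r by (intro rem) auto
      also have "\<dots> \<le> C0 * (r * (X + Y))" using C0 XY r by (intro mult_left_mono mult_mono) auto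
      finally have R1: "\<bar>R1\<bar> \<le> C0 * (r * (X + Y))" .
      have R2: "\<bar>R2\<bar> \<le> C2 * (r * (X + Y))"
        unfolding R2_def X_def Y_def using r by (intro C2(2)) auto
      have "V' z (\<sigma> *\<^sub>R planar_system k l s m z) = \<sigma> * V' (x, y) (planar_system k l s m (x, y))"
        by (simp add: V'_def xy algebra_simps)
      also have "\<dots> = \<sigma> * ((\<theta> - 1) * X + (R1 + \<beta> * Y) + \<theta> * R2)"
        unfolding V'_planar R1_def R2_def X_def by simp
      also have "\<dots> = \<sigma> * (\<theta> - 1) * X + \<sigma> * \<beta> * Y + \<sigma> * (R1 + \<theta> * R2)"
        by (simp add: algebra_simps)
      also have "\<dots> \<le> - c * X + - c * Y + \<bar>R1 + \<theta> * R2\<bar>"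
      proof (intro add_mono mult_right_mono c XY)
        show "\<sigma> * (R1 + \<theta> * R2) \<le> \<bar>R1 + \<theta> * R2\<bar>"
          using abs_ge_self[of "\<sigma> * (R1 + \<theta> * R2)"] \<sigma>(1) by (simp add: abs_mult)
      qed
      also have "\<bar>R1 + \<theta> * R2\<bar> \<le> C0 * (r * (X + Y)) + \<bar>\<theta>\<bar> * (C2 * (r * (X + Y)))"
        using R1 mult_left_mono[OF R2, of "\<bar>\<theta>\<bar>"] abs_triangle_ineq[of R1 "\<theta> * R2"]
        by (simp add: abs_mult)
      \<comment> \<open>The errors carry the factor \<open>r\<close>, the norm of \<open>z\<close>,
        and so lose against \<open>c\<close> on the small ball.\<close>
      also have "- c * X + - c * Y + (C0 * (r * (X + Y)) + \<bar>\<theta>\<bar> * (C2 * (r * (X + Y))))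
          = (B * r - c) * (X + Y)"
        by (simp add: B_def algebra_simps)
      also have "\<dots> < 0" using \<rho>2(2)[OF r(4)] XY by (intro mult_neg_pos) auto
      finally show ?thesis by simp
    qed
  qed (use \<rho> in simp)
  then show ?thesis by (simp add: zero_prod_def)
qed

section \<open>Choice of the parameters in each case\<close>

lemma m_star_pos:
  assumes "1 \<le> l"
  shows "0 < m_star k l"
  unfolding corrector_coeff_last[OF assms, symmetric] corrector_coeff_def
  by (intro prod_pos divide_pos_pos) (auto simp: add_pos_nonneg)

text \<open>Puts a pure power of \<open>y\<close> of order higher than the leading one into the form
  of the remainder; an exponent above \<open>2*q\<close> leaves at least one spare factor of size at
  most 1.\<close>

lemma abs_mult_even_power_le:
  fixes y c :: real
  assumes "\<bar>y\<bar> \<le> 1" "2 * q < p"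
  shows "\<bar>c * y ^ p\<bar> \<le> \<bar>c\<bar> * (\<bar>y\<bar> * y ^ (2 * q))"
proof -
  have "\<bar>y\<bar> ^ p \<le> \<bar>y\<bar> ^ (2 * q + 1)" using assms by (intro power_decreasing) auto
  also have "\<dots> = \<bar>y\<bar> * y ^ (2 * q)" by (simp add: power_mult)
  finally show ?thesis by (simp add: abs_mult power_abs mult_left_mono)
qed

text \<open>For \<open>s = k*l\<close> the two powers of \<open>y\<close> coincide and merge with
  coefficient \<open>m - \<theta> * m_star k l\<close>, leaving no remainder. Both this and
  \<open>\<theta> - 1\<close> can be made negative exactly when \<open>m\<close> is below
  \<open>m_star k l\<close>. The lemma also serves \<open>m = 0\<close>.\<close>

lemma attractor_below_m_star:
  assumes "1 \<le> k" "1 \<le> l" "l \<le> 2 * (k * l)" "m < m_star k l"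
  shows "attractor (planar_system k l (k * l) m) (0, 0)"
proof -
  have "max 0 (m / m_star k l) < 1" using assms m_star_pos[of l k] by simp
  then obtain \<theta> where \<theta>: "max 0 (m / m_star k l) < \<theta>" "\<theta> < 1" using dense by blast
  then have "m < \<theta> * m_star k l" using m_star_pos[of l k] assms by (simp add: divide_less_eq)
  then have "asymptotically_stable_equilibrium (\<lambda>z. 1 *\<^sub>R planar_system k l (k * l) m z) (0, 0)"
    using assms \<theta>
    by (intro planar_system_asymptotically_stable[where \<theta> = \<theta> and N = "k * l"
          and \<beta> = "m - \<theta> * m_star k l" and ?C0.0 = 0]) (auto simp: algebra_simps)
  then show ?thesis by (simp add: attractor_def)
qed

theorem theorem1p2:
  fixes k l s :: nat and m :: real
  assumes "k \<ge> 1" and "l \<ge> 1" and "s \<ge> 1" and "2 \<le> l" and "l \<le> 2 * s"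
  shows "(s < k * l \<longrightarrow>
            (m \<le> 0 \<longrightarrow> attractor (planar_system k l s m) (0, 0)) \<and>
            (m > 0 \<longrightarrow> repeller (planar_system k l s m) (0, 0))) \<and>
         (s > k * l \<longrightarrow> attractor (planar_system k l s m) (0, 0)) \<and>
         (s = k * l \<longrightarrow>
            (m < m_star k l \<longrightarrow> attractor (planar_system k l s m) (0, 0)) \<and>
            (m > m_star k l \<longrightarrow> repeller (planar_system k l s m) (0, 0)))"
proof (intro conjI impI)
  note ms = m_star_pos[OF assms(2), of k]
  \<comment> \<open>In every use below \<open>N\<close> is the minimum of \<open>s\<close> and
    \<open>k * l\<close>, so that \<open>2*l + 2*N\<close> is the lowest order among the two powers
    of \<open>y\<close>.\<close>
  note stable = planar_system_asymptotically_stable[OF assms(1,2,5)]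
  have exp1: "2 * l * (k + 1) = 2 * (k * l + l)" by (simp add: algebra_simps)
  have kl: "l \<le> k * l" using assms by simp
  show "attractor (planar_system k l s m) (0, 0)" if "s < k * l" "m \<le> 0"
  \<comment> \<open>For \<open>m = 0\<close> the Hamiltonian has only a semidefinite derivative, but
    \<open>s\<close> drops out of the system and may be taken to be \<open>k * l\<close>, where
    \<open>0 < m_star k l\<close>. For \<open>m < 0\<close> the Hamiltonian itself works, so
    \<open>\<theta> = 0\<close>.\<close>
  proof (cases "m = 0")
    case True
    then have "planar_system k l s m = planar_system k l (k * l) m"
      by (simp add: planar_system_def)
    moreover have "attractor (planar_system k l (k * l) m) (0, 0)"
      using assms kl ms True by (intro attractor_below_m_star) auto
    ultimately show ?thesis by simp
  next
    case False
    have "asymptotically_stable_equilibrium (\<lambda>z. 1 *\<^sub>R planar_system k l s m z) (0, 0)"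
      using that False by (intro stable[where N = s and \<theta> = 0 and \<beta> = m and ?C0.0 = 0]) auto
    then show ?thesis by (simp add: attractor_def)
  qed
  show "repeller (planar_system k l s m) (0, 0)" if "s < k * l" "m > 0"
  proof -
    have "asymptotically_stable_equilibrium (\<lambda>z. (- 1) *\<^sub>R planar_system k l s m z) (0, 0)"
    \<comment> \<open>Reversed time needs \<open>\<theta> > 1\<close>; the value 2 is one choice.
      Since \<open>s < k*l\<close>, the power of \<open>y\<close> coming from the corrector is of
      higher order and goes into the remainder, so the sign of \<open>m\<close> decides.\<close>
    proof (rule stable[where N = s and \<theta> = 2 and \<beta> = m and ?C0.0 = "\<bar>2 * m_star k l\<bar>"])
      fix y :: real assume "\<bar>y\<bar> \<le> 1"
      then show "\<bar>m * y ^ (2 * l + 2 * s) - 2 * (m_star k l * y ^ (2 * l * (k + 1))) - m * y ^ (2 * l + 2 * s)\<bar>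
          \<le> \<bar>2 * m_star k l\<bar> * (\<bar>y\<bar> * y ^ (2 * l + 2 * s))"
        using abs_mult_even_power_le[of y "l + s" "2 * l * (k + 1)" "2 * m_star k l"] that
        by (simp add: exp1 abs_mult mult.commute)
    qed (use that in auto)
    then show ?thesis by (simp add: repeller_def)
  qed
  show "attractor (planar_system k l s m) (0, 0)" if "s > k * l"
  proof -
    have "asymptotically_stable_equilibrium (\<lambda>z. 1 *\<^sub>R planar_system k l s m z) (0, 0)"
    \<comment> \<open>Any \<open>\<theta>\<close> strictly between 0 and 1 would do. Since
      \<open>s > k*l\<close>, now the term in \<open>m\<close> is the remainder, and the corrector
      supplies the negative coefficient of \<open>y\<close>.\<close>
    proof (rule stable[where N = "k * l" and \<theta> = "1 / 2" and \<beta> = "- (1 / 2 * m_star k l)" and ?C0.0 = "\<bar>m\<bar>"])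
      fix y :: real assume "\<bar>y\<bar> \<le> 1"
      moreover have e: "2 * l * (k + 1) = 2 * l + 2 * (k * l)" by (simp add: algebra_simps)
      ultimately show "\<bar>m * y ^ (2 * l + 2 * s) - 1 / 2 * (m_star k l * y ^ (2 * l * (k + 1)))
            - - (1 / 2 * m_star k l) * y ^ (2 * l + 2 * (k * l))\<bar>
          \<le> \<bar>m\<bar> * (\<bar>y\<bar> * y ^ (2 * l + 2 * (k * l)))"
        unfolding e using abs_mult_even_power_le[of y "l + k * l" "2 * l + 2 * s" m] that by simp
    qed (use that ms in auto)
    then show ?thesis by (simp add: attractor_def)
  qed
  show "attractor (planar_system k l s m) (0, 0)" if "s = k * l" "m < m_star k l"
    using attractor_below_m_star[of k l m] assms that by simp
  show "repeller (planar_system k l s m) (0, 0)" if "s = k * l" "m > m_star k l"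
  proof -
    \<comment> \<open>With \<open>\<theta>\<close> strictly between 1 and
      \<open>m / m_star k l\<close>, both leading coefficients are positive, hence negative for
      reversed time.\<close>
    have "1 < m / m_star k l" using that ms by simp
    then obtain \<theta> where \<theta>: "1 < \<theta>" "\<theta> < m / m_star k l" using dense by blast
    then have "\<theta> * m_star k l < m" using ms by (simp add: less_divide_eq)
    then have "asymptotically_stable_equilibrium (\<lambda>z. (- 1) *\<^sub>R planar_system k l s m z) (0, 0)"
      using that \<theta>
      by (intro stable[where N = "k * l" and \<theta> = \<theta> and \<beta> = "m - \<theta> * m_star k l" and ?C0.0 = 0])
         (auto simp: algebra_simps)
    then show ?thesis by (simp add: repeller_def)
  qed
qed

end
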